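(* Let $U$ be the unitary transformation on $L^2_{\mathbb{C}}(V\times S)$ associated with a discrete-time quantum walk (not necessarily coined) on a finite graph $G=(V,E)$ with finite set of states $S$. Let $U$ have $m$ distinct eigenvalues and relaxation time $t_{rel}$. Then $$t_{mix}(\varepsilon)\le 2\pi \log(2m)\,\frac{t_{rel}}{\varepsilon}.$$
   Context: Quantum walk: $G=(V,E)$ is a finite graph, $S$ is a finite set (of "chiralities"), and $U$ is a unitary operator on $L^2_{\mathbb{C}}(V\times S)$. The walk is assumed local: with $\delta_x$ the standard basis vectors, if $x=(v,s)$, $x'=(v',s')$ and $\langle\delta_{x'},U\delta_x\rangle\ne 0$, then $v$ and $v'$ are connected to each other in $G$. For an initial wave function $\psi\in L^2_{\mathbb{C}}(V\times S)$ with $\|\psi\|=1$, put $\psi_t=U^t\psi$. ("Not necessarily coined" means that $U$ need not have the special form given by a coin matrix acting on $S$ followed by moves along labelled edges; any local unitary $U$ is allowed.) Mixing time: the limit $$p(x)=\lim_{T\to\infty}\frac1T\sum_{t=0}^{T-1}|\psi_t(x)|^2$$ exists for each $x$ (and may depend on $\psi$). For $T=1,2,\dots$ let $$d(T,\psi)=\sum_{x\in V\times S}\left|\frac1T\sum_{t=0}^{T-1}|\psi_t(x)|^2-p(x)\right|.$$ The mixing time is $$t_{mix}(\varepsilon)=\sup_{\psi}\ \inf\{T: d(T',\psi)\le\varepsilon \text{ for all } T'\ge T\},$$ the supremum being over all wave functions $\psi$ with $\|\psi\|=1$. Relaxation time: let $\lambda_k=e^{i\beta_k}$, $k=1,\dots,m$,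 be the distinct eigenvalues of $U$, and $d(\lambda_k,\lambda_l)=\min\{|\beta_k-\beta_l+2\pi n|: n\in\mathbb{Z}\}$. Then $t_{rel}=\max_{k\ne l} d(\lambda_k,\lambda_l)^{-1}$. $\log$ is the natural logarithm.
   Formalization: Assumes m ≥ 2 (otherwise t_rel is a maximum over the empty set), ε > 0, and ε ≤ 2π log(2m) t_rel: since T = 1, 2, …, always t_mix(ε) ≥ 1, so the claimed bound is false for larger ε; every ε in (0, 2] is covered. *)

theory Defs
  imports "HOL-Analysis.Analysis" "Graph_Theory.Digraph"
begin

text \<open>
  The space of complex-valued L2 functions on the finite set \<open>V \<times> S\<close> is \<open>complex ^ ('v \<times> 's)\<close>,
  whose library norm is the L2 norm. The library inner product \<open>(\<bullet>)\<close> on this type is the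
  real part of the Hermitian product, hence the following definition.
\<close>

definition cinner :: "complex ^ 'n::finite \<Rightarrow> complex ^ 'n \<Rightarrow> complex" where
  "cinner \<phi> \<psi> = (\<Sum>x\<in>UNIV. cnj (\<phi> $ x) * \<psi> $ x)"

definition unitary_operator :: "(complex ^ 'n::finite \<Rightarrow> complex ^ 'n) \<Rightarrow> bool" where
  "unitary_operator U \<longleftrightarrow>
     Vector_Spaces.linear (*s) (*s) U \<and> bij U \<and> (\<forall>\<phi> \<psi>. cinner (U \<phi>) (U \<psi>) = cinner \<phi> \<psi>)"

definition eigenvalues :: "(complex ^ 'n::finite \<Rightarrow> complex ^ 'n) \<Rightarrow> complex set" where
  "eigenvalues U = {\<nu>. \<exists>\<psi>. \<psi> \<noteq> 0 \<and> U \<psi> = \<nu> *s \<psi>}"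

text \<open>
  A \<open>pseudo_graph\<close> is a finite undirected graph, encoded by symmetric arcs; loops and multiple
  edges are permitted but not required. The vertex set \<open>V\<close> is the whole type \<open>'v\<close>, and the set \<open>S\<close> of
  chiralities is the type \<open>'s\<close>.
\<close>

locale quantum_walk = pseudo_graph G
  for G :: "('v::finite, 'e) pre_digraph" (structure) +
  fixes U :: "complex ^ ('v \<times> 's::finite) \<Rightarrow> complex ^ ('v \<times> 's)"
  assumes verts_UNIV: "verts G = UNIV"
    and unitary: "unitary_operator U"
    and local: "\<And>v s v' s'. cinner (axis (v', s') 1) (U (axis (v, s) 1)) \<noteq> 0 \<Longrightarrow> v \<rightarrow> v'"

definition avg_prob :: "(complex ^ 'n::finite \<Rightarrow> complex ^ 'n) \<Rightarrow> complex ^ 'n \<Rightarrow> nat \<Rightarrow> 'n \<Rightarrow> real" where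
  "avg_prob U \<psi> T x = 1 / real T * (\<Sum>t<T. (cmod ((U ^^ t) \<psi> $ x))\<^sup>2)"

definition limit_prob :: "(complex ^ 'n::finite \<Rightarrow> complex ^ 'n) \<Rightarrow> complex ^ 'n \<Rightarrow> 'n \<Rightarrow> real" where
  "limit_prob U \<psi> x = lim (\<lambda>T. avg_prob U \<psi> T x)"

definition mixing_dist :: "(complex ^ 'n::finite \<Rightarrow> complex ^ 'n) \<Rightarrow> nat \<Rightarrow> complex ^ 'n \<Rightarrow> real" where
  "mixing_dist U T \<psi> = (\<Sum>x\<in>UNIV. \<bar>avg_prob U \<psi> T x - limit_prob U \<psi> x\<bar>)"

text \<open>
  The values are extended reals, so that an infimum over the empty set and an unbounded supremum
  are both \<open>\<infinity>\<close>; a finite upper bound then includes finiteness.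
\<close>

definition mixing_time :: "(complex ^ 'n::finite \<Rightarrow> complex ^ 'n) \<Rightarrow> real \<Rightarrow> ereal" where
  "mixing_time U \<epsilon> =
     (SUP \<psi>\<in>{\<psi>. norm \<psi> = 1}.
        INF T\<in>{T. 1 \<le> T \<and> (\<forall>T'\<ge>T. mixing_dist U T' \<psi> \<le> \<epsilon>)}. ereal (real T))"

definition phase_dist :: "complex \<Rightarrow> complex \<Rightarrow> real" where
  "phase_dist \<nu> \<mu> = (INF n::int. \<bar>Arg \<nu> - Arg \<mu> + 2 * pi * of_int n\<bar>)"

text \<open>Meaningful only if there are at least two distinct eigenvalues.\<close>

definition relaxation_time :: "(complex ^ 'n::finite \<Rightarrow> complex ^ 'n) \<Rightarrow> real" where
  "relaxation_time U =
     Max {inverse (phase_dist \<nu> \<mu>) | \<nu> \<mu>. \<nu> \<in> eigenvalues U \<and> \<mu> \<in> eigenvalues U \<and> \<nu> \<noteq> \<mu>}"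

text \<open>
  Times \<open>T\<close> range over \<open>1, 2, \<dots>\<close>, so the mixing time is never below \<open>1\<close>, and any upper bound for it
  must itself be at least \<open>1\<close>. For a bound of the form \<open>C / \<epsilon>\<close> this forces \<open>\<epsilon> \<le> C\<close>. With
  \<open>C = 2 \<pi> log (2 m) t\<close>, where \<open>t\<close> is the relaxation time, this holds for all \<open>\<epsilon> \<le> 2\<close>.
\<close>

lemma one_le_mixing_time: "1 \<le> mixing_time (U :: complex ^ 'n::finite \<Rightarrow> complex ^ 'n) \<epsilon>"
proof -
  obtain i :: 'n where True by simp
  have n: "norm (axis i (1::complex)) = 1" by (simp add: norm_axis_1)
  have "1 \<le> (INF T\<in>{T. 1 \<le> T \<and> (\<forall>T'\<ge>T. mixing_dist U T' (axis i 1) \<le> \<epsilon>)}. ereal (real T))"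
    by (rule INF_greatest) (simp add: one_ereal_def)
  also have "\<dots> \<le> mixing_time U \<epsilon>"
    unfolding mixing_time_def by (rule SUP_upper) (use n in simp)
  finally show ?thesis .
qed

lemma cinner_scaleC:
  "cinner (a *s \<phi>) (b *s \<psi>) = cnj a * b * cinner \<phi> \<psi>"
  by (simp add: cinner_def sum_distrib_left mult_ac)

lemma cinner_self: "cinner \<psi> \<psi> = of_real ((norm \<psi>)\<^sup>2)"
  by (simp add: cinner_def norm_vec_def L2_set_def sum_nonneg mult.commute
      complex_norm_square[symmetric])

lemma Re_cinner: "Re (cinner \<phi> \<psi>) = \<phi> \<bullet> \<psi>"
  by (simp add: cinner_def inner_vec_def inner_complex_def)

lemma eigenvalue_norm:
  assumes "unitary_operator U" "\<nu> \<in> eigenvalues U"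
  shows "cmod \<nu> = 1"
proof -
  obtain \<psi> where p: "\<psi> \<noteq> 0" "U \<psi> = \<nu> *s \<psi>" using assms(2) by (auto simp: eigenvalues_def)
  have "cinner (U \<psi>) (U \<psi>) = cinner \<psi> \<psi>" using assms(1) by (simp add: unitary_operator_def)
  then have "cnj \<nu> * \<nu> * cinner \<psi> \<psi> = cinner \<psi> \<psi>" by (simp add: p cinner_scaleC)
  then have "\<nu> * cnj \<nu> = 1" using p by (simp add: cinner_self mult.commute)
  then have "of_real ((cmod \<nu>)\<^sup>2) = (1::complex)" by (metis complex_norm_square)
  then have "(cmod \<nu>)\<^sup>2 = 1" using of_real_eq_1_iff by blast
  then show ?thesis by (simp add: power2_eq_1_iff) (metis norm_ge_zero not_one_le_zero
        neg_0_le_iff_le)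
qed

lemma finite_eigenvalues:
  fixes U :: "complex ^ 'n::finite \<Rightarrow> complex ^ 'n"
  assumes U: "unitary_operator U"
  shows "finite (eigenvalues U)"
proof -
  have "\<forall>\<nu>\<in>eigenvalues U. \<exists>\<psi>. \<psi> \<noteq> 0 \<and> U \<psi> = \<nu> *s \<psi>" by (simp add: eigenvalues_def)
  then obtain f where f: "\<And>\<nu>. \<nu> \<in> eigenvalues U \<Longrightarrow> f \<nu> \<noteq> 0 \<and> U (f \<nu>) = \<nu> *s f \<nu>"
    by (auto dest!: bchoice)
  have orth: "f \<nu> \<bullet> f \<mu> = 0"
    if "\<nu> \<in> eigenvalues U" "\<mu> \<in> eigenvalues U" "\<nu> \<noteq> \<mu>" for \<nu> \<mu>
  proof -
    have "cinner (U (f \<nu>)) (U (f \<mu>)) = cinner (f \<nu>) (f \<mu>)"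
      using U by (simp add: unitary_operator_def)
    then have e: "cnj \<nu> * \<mu> * cinner (f \<nu>) (f \<mu>) = cinner (f \<nu>) (f \<mu>)"
      using f that by (simp add: cinner_scaleC)
    have "\<nu> * cnj \<nu> = 1" using eigenvalue_norm[OF U that(1)]
      by (simp add: complex_norm_square[symmetric])
    then have "cnj \<nu> * \<mu> \<noteq> 1" using that(3)
      by (metis mult.assoc mult.right_neutral mult_1)
    then have "cinner (f \<nu>) (f \<mu>) = 0" using e by simp
    then show ?thesis by (metis Re_cinner zero_complex.sel(1))
  qed
  have inj: "inj_on f (eigenvalues U)"
    by (rule inj_onI) (metis orth f inner_eq_zero_iff)
  have "independent (f ` eigenvalues U)"
    by (rule pairwise_orthogonal_independent)
      (use orth f in \<open>auto simp: pairwise_def orthogonal_def\<close>)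
  then have "finite (f ` eigenvalues U)" by (rule independent_imp_finite)
  then show ?thesis using inj finite_imageD by blast
qed

lemma phase_dist_bounds:
  assumes "cmod \<nu> = 1" "cmod \<mu> = 1" "\<nu> \<noteq> \<mu>"
  shows "0 < phase_dist \<nu> \<mu>" "phase_dist \<nu> \<mu> \<le> pi"
proof -
  define x where "x = Arg \<nu> - Arg \<mu>"
  have "z = cis (Arg z)" if "cmod z = 1" for z
    using that cis_Arg[of z] by (cases "z = 0") (auto simp: sgn_eq)
  then have "\<nu> = cis (Arg \<nu>)" "\<mu> = cis (Arg \<mu>)" using assms by blast+
  then have x0: "x \<noteq> 0" using assms(3) unfolding x_def by auto
  have x2: "\<bar>x\<bar> < 2 * pi"
    using mpi_less_Arg[of \<nu>] mpi_less_Arg[of \<mu>] Arg_le_pi[of \<nu>] Arg_le_pi[of \<mu>]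
    unfolding x_def by linarith
  have d: "phase_dist \<nu> \<mu> = (INF n::int. \<bar>x + 2 * pi * of_int n\<bar>)"
    by (simp add: phase_dist_def x_def)
  have "min \<bar>x\<bar> (2 * pi - \<bar>x\<bar>) \<le> \<bar>x + 2 * pi * of_int n\<bar>" for n :: int
  proof (cases "n = 0")
    case False
    then have "1 \<le> \<bar>real_of_int n\<bar>" by linarith
    then have "2 * pi * 1 \<le> 2 * pi * \<bar>real_of_int n\<bar>" by (intro mult_left_mono) auto
    also have "\<dots> = \<bar>2 * pi * of_int n\<bar>" by (simp add: abs_mult)
    finally show ?thesis by linarith
  qed simp
  then have "min \<bar>x\<bar> (2 * pi - \<bar>x\<bar>) \<le> phase_dist \<nu> \<mu>"
    unfolding d by (intro cINF_greatest) auto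
  then show "0 < phase_dist \<nu> \<mu>" using x0 x2 by linarith
  have b: "phase_dist \<nu> \<mu> \<le> \<bar>x + 2 * pi * of_int n\<bar>" for n :: int
    unfolding d by (rule cINF_lower) (auto intro!: bdd_belowI[of _ 0])
  show "phase_dist \<nu> \<mu> \<le> pi"
    using b[of 0] b[of 1] b[of "-1"] x2 by (auto simp: abs_if split: if_splits)
qed

lemma two_le_mixing_bound:
  fixes U :: "complex ^ 'n::finite \<Rightarrow> complex ^ 'n"
  assumes U: "unitary_operator U" and m: "2 \<le> card (eigenvalues U)"
  shows "2 \<le> 2 * pi * ln (2 * real (card (eigenvalues U))) * relaxation_time U"
proof -
  let ?E = "eigenvalues U"
  let ?A = "{inverse (phase_dist \<nu> \<mu>) | \<nu> \<mu>. \<nu> \<in> ?E \<and> \<mu> \<in> ?E \<and> \<nu> \<noteq> \<mu>}"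
  have fin: "finite ?E" by (rule finite_eigenvalues[OF U])
  have "?A \<subseteq> (\<lambda>(\<nu>, \<mu>). inverse (phase_dist \<nu> \<mu>)) ` (?E \<times> ?E)" by auto
  then have finA: "finite ?A" using fin by (meson finite_SigmaI finite_imageI finite_subset)
  obtain \<nu> \<mu> where lm: "\<nu> \<in> ?E" "\<mu> \<in> ?E" "\<nu> \<noteq> \<mu>"
    using m fin by (metis card_le_Suc0_iff_eq not_less_eq_eq numeral_2_eq_2)
  note pd = phase_dist_bounds[OF eigenvalue_norm[OF U lm(1)] eigenvalue_norm[OF U lm(2)] lm(3)]
  have "inverse pi \<le> inverse (phase_dist \<nu> \<mu>)" using pd by (simp add: le_imp_inverse_le)
  also have "\<dots> \<le> relaxation_time U"
    unfolding relaxation_time_def by (rule Max_ge[OF finA]) (use lm in blast)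
  finally have r: "inverse pi \<le> relaxation_time U" .
  have "exp 1 \<le> 2 * real (card ?E)" using exp_le m by linarith
  then have "1 \<le> ln (2 * real (card ?E))" using m by (subst ln_ge_iff) auto
  then have "2 * pi * 1 * inverse pi \<le> 2 * pi * ln (2 * real (card ?E)) * relaxation_time U"
    using r by (intro mult_mono) auto
  then show ?thesis by simp
qed

end

theory Submission
  imports Defs "HOL-Computational_Algebra.Fundamental_Theorem_Algebra"
begin

text \<open>
  Decompose \<open>\<psi>\<close> into eigenvectors \<open>f \<nu>\<close> of \<open>U\<close>. The limit distribution is \<open>\<Sum>\<nu>. \<bar>f \<nu> x\<bar>\<^sup>2\<close>, and the
  deviation of the time average from it consists of the cross terms \<open>\<nu> \<noteq> \<mu>\<close>, each weighted by a
  geometric sum of modulus at most \<open>2 / (T \<bar>\<nu> - \<mu>\<bar>)\<close>. Summing over \<open>x\<close> (Cauchy--Schwarz) leaves a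
  quadratic form in the norms of the \<open>f \<nu>\<close>, bounded by the largest row sum of
  \<open>1 / \<bar>\<nu> - \<mu>\<bar>\<close>. Seen from \<open>\<mu>\<close>, the other \<open>m - 1\<close> eigenvalues lie on two half circles, with phases
  separated by \<open>1 / t\<close> where \<open>t\<close> is the relaxation time, so a row sum is at most
  \<open>\<pi> / 2\<close> times \<open>t (H r + H s)\<close> with harmonic numbers and \<open>r + s = m - 1\<close>, which is at most \<open>\<pi> t ln m\<close>.
\<close>

section \<open>Eigenvector decomposition for unitary operators\<close>

lemma unitary_operatorD:
  assumes "unitary_operator U"
  shows "U (\<phi> + \<psi>) = U \<phi> + U \<psi>" "U (\<phi> - \<psi>) = U \<phi> - U \<psi>" "U (c *s \<phi>) = c *s U \<phi>" "U 0 = 0"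
    "U (sum f A) = (\<Sum>i\<in>A. U (f i))" "cinner (U \<phi>) (U \<psi>) = cinner \<phi> \<psi>"
proof -
  interpret Vector_Spaces.linear "(*s)" "(*s)" U
    using assms by (simp add: unitary_operator_def)
  show "U (\<phi> + \<psi>) = U \<phi> + U \<psi>" "U (\<phi> - \<psi>) = U \<phi> - U \<psi>" "U (c *s \<phi>) = c *s U \<phi>" "U 0 = 0"
    "U (sum f A) = (\<Sum>i\<in>A. U (f i))"
    by (fact add diff scale zero sum)+
  show "cinner (U \<phi>) (U \<psi>) = cinner \<phi> \<psi>"
    using assms by (simp add: unitary_operator_def)
qed

section \<open>Polynomials in \<open>U\<close> applied to a vector\<close>

definition poly_op :: "complex poly \<Rightarrow> (complex ^ 'n::finite \<Rightarrow> complex ^ 'n) \<Rightarrow> complex ^ 'n \<Rightarrow> complex ^ 'n" where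
  "poly_op p U \<psi> = (\<Sum>i\<le>degree p. coeff p i *s (U ^^ i) \<psi>)"

lemma poly_op_eq_sum:
  assumes "degree p \<le> N"
  shows "poly_op p U \<psi> = (\<Sum>i\<le>N. coeff p i *s (U ^^ i) \<psi>)"
  unfolding poly_op_def
  by (rule sum.mono_neutral_left) (use assms in \<open>auto simp: coeff_eq_0\<close>)

lemma poly_op_pCons_0:
  "poly_op (pCons 0 q) U \<psi> = poly_op q U (U \<psi>)"
proof -
  have "poly_op (pCons 0 q) U \<psi> = (\<Sum>i\<le>Suc (degree q). coeff (pCons 0 q) i *s (U ^^ i) \<psi>)"
    by (rule poly_op_eq_sum) (simp add: degree_pCons_le)
  also have "\<dots> = poly_op q U (U \<psi>)"
    by (subst sum.atMost_Suc_shift) (simp add: poly_op_def funpow_swap1 vec_eq_iff)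
  finally show ?thesis .
qed

lemma funpow_diff_scale:
  assumes "unitary_operator U"
  shows "(U ^^ i) (\<phi> - c *s \<psi>) = (U ^^ i) \<phi> - c *s (U ^^ i) \<psi>"
  by (induction i) (simp_all add: unitary_operatorD[OF assms])

text \<open>\<open>U - a\<close> commutes with \<open>q(U)\<close>, so a linear factor can act on
  the vector first. This trades a root of the polynomial for a new vector and drives the induction
  on the degree.\<close>

lemma poly_op_mult_linear:
  assumes "unitary_operator U"
  shows "poly_op ([:- a, 1:] * q) U \<psi> = poly_op q U (U \<psi> - a *s \<psi>)"
proof -
  have "poly_op ([:- a, 1:] * q) U \<psi> = poly_op (pCons 0 q - smult a q) U \<psi>"
    by (rule arg_cong[where f = "\<lambda>p. poly_op p U \<psi>"]) simp
  also have "\<dots> = (\<Sum>i\<le>Suc (degree q). coeff (pCons 0 q - smult a q) i *s (U ^^ i) \<psi>)"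
    by (rule poly_op_eq_sum, rule degree_diff_le)
      (auto simp: degree_pCons_le intro: le_trans[OF degree_smult_le])
  also have "\<dots> = (\<Sum>i\<le>Suc (degree q). coeff (pCons 0 q) i *s (U ^^ i) \<psi>)
      - a *s (\<Sum>i\<le>Suc (degree q). coeff q i *s (U ^^ i) \<psi>)"
    by (simp only: coeff_diff coeff_smult vec.scale_left_diff_distrib sum_subtractf
        vec.scale_sum_right vec.scale_scale)
  also have "\<dots> = poly_op (pCons 0 q) U \<psi> - a *s poly_op q U \<psi>"
    by (simp only: poly_op_eq_sum[of "pCons 0 q" "Suc (degree q)"] degree_pCons_le
        poly_op_eq_sum[of q "Suc (degree q)"] le_SucI[OF order_refl])
  also have "\<dots> = poly_op q U (U \<psi> - a *s \<psi>)"
    unfolding poly_op_pCons_0 unfolding poly_op_def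
    by (simp add: funpow_diff_scale[OF assms] vec.scale_right_diff_distrib sum_subtractf
        vec.scale_sum_right mult.commute)
  finally show ?thesis .
qed

text \<open>The iterates with exponents \<open>0\<close> to \<open>?N\<close> are one more than the
  real dimension, so they are linearly dependent already over the reals.\<close>

lemma ex_annihilating_poly:
  fixes U :: "complex ^ 'n::finite \<Rightarrow> complex ^ 'n"
  shows "\<exists>p. p \<noteq> 0 \<and> poly_op p U \<psi> = 0"
proof -
  let ?N = "DIM(complex ^ 'n)"
  let ?v = "\<lambda>i. (U ^^ i) \<psi>"
  have conclude: ?thesis if c: "c j \<noteq> 0" "j \<le> ?N" "(\<Sum>i\<le>?N. complex_of_real (c i) *s ?v i) = 0" for c j
  proof -
    let ?p = "Poly (map (\<lambda>i. complex_of_real (c i)) [0..<Suc ?N])"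
    have co: "coeff ?p i = complex_of_real (c i)" if "i \<le> ?N" for i
      using that by (simp add: nth_default_def del: upt_Suc)
    have "degree ?p \<le> ?N"
      by (rule degree_le) (simp add: nth_default_def del: upt_Suc)
    then have "poly_op ?p U \<psi> = (\<Sum>i\<le>?N. complex_of_real (c i) *s ?v i)"
      unfolding poly_op_eq_sum[OF \<open>degree ?p \<le> ?N\<close>] by (intro sum.cong) (simp_all only: co atMost_iff)
    then have "poly_op ?p U \<psi> = 0" using c(3) by simp
    moreover have "?p \<noteq> 0" using co[OF c(2)] c(1) by (metis coeff_0 of_real_eq_0_iff)
    ultimately show ?thesis by blast
  qed
  show ?thesis
  proof (cases "inj_on ?v {..?N}")
    case True
    then have "dependent (?v ` {..?N})"
      by (intro dependent_biggerset) (simp add: card_image)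
    then obtain u j where u: "j \<le> ?N" "u (?v j) \<noteq> 0" "(\<Sum>w\<in>?v ` {..?N}. u w *\<^sub>R w) = 0"
      by (auto simp: dependent_finite)
    have "(\<Sum>i\<le>?N. complex_of_real (u (?v i)) *s ?v i) = (\<Sum>w\<in>?v ` {..?N}. u w *\<^sub>R w)"
      by (subst sum.reindex[OF True]) (simp add: vec_eq_iff scaleR_conv_of_real[where 'a = complex])
    then show ?thesis using conclude[of "\<lambda>i. u (?v i)" j] u by simp
  next
    case False
    then obtain i j where ij: "i \<le> ?N" "j \<le> ?N" "i \<noteq> j" "?v i = ?v j"
      by (auto simp: inj_on_def)
    \<comment> \<open>Coinciding iterates collapse in the set of iterates, so the dimension count
      says nothing here; the polynomial X^i - X^j annihilates instead.\<close>
    have "(\<Sum>k\<le>?N. complex_of_real (of_bool (k = i) - of_bool (k = j)) *s ?v k)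
      = (\<Sum>k\<le>?N. if k = i then ?v k else 0) - (\<Sum>k\<le>?N. if k = j then ?v k else 0)"
      by (subst sum_subtractf[symmetric], rule sum.cong) (auto simp: vec_eq_iff)
    also have "\<dots> = 0" using ij by simp
    finally show ?thesis using conclude[of "\<lambda>k. of_bool (k = i) - of_bool (k = j)" i] ij by simp
  qed
qed

lemma cinner_diff_right: "cinner \<phi> (\<psi> - \<xi>) = cinner \<phi> \<psi> - cinner \<phi> \<xi>"
  by (simp add: cinner_def algebra_simps sum_subtractf)

text \<open>This is where unitarity makes \<open>U\<close> diagonalizable: there are no Jordan blocks of size 2.\<close>

lemma eigenvector_in_range_eq_0:
  assumes U: "unitary_operator U" and e: "U \<phi> = a *s \<phi>" and \<phi>: "U \<xi> - a *s \<xi> = \<phi>"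
  shows "\<phi> = 0"
proof (rule ccontr)
  assume nz: "\<phi> \<noteq> 0"
  then have "cmod a = 1" using U e by (intro eigenvalue_norm) (auto simp: eigenvalues_def)
  then have a: "a * cnj a = 1" by (simp add: complex_norm_square[symmetric])
  have "cinner \<phi> \<xi> = cinner (U \<phi>) (U \<xi>)" by (simp add: unitary_operatorD[OF U])
  also have "\<dots> = cnj a * cinner \<phi> (U \<xi>)" using cinner_scaleC[of a \<phi> 1] by (simp add: e)
  finally have "a * cinner \<phi> \<xi> = cinner \<phi> (U \<xi>)" by (metis a mult.assoc mult_1)
  moreover have "cinner \<phi> (a *s \<xi>) = a * cinner \<phi> \<xi>" using cinner_scaleC[of 1 \<phi> a] by simp
  ultimately have "cinner \<phi> \<phi> = 0" by (subst (2) \<phi>[symmetric]) (simp add: cinner_diff_right)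
  then show False using nz by (simp add: cinner_self)
qed

text \<open>Split off a root \<open>a\<close>. By induction \<open>U \<psi> - a *s \<psi>\<close> is
  a sum of eigenvectors, and \<open>U - a\<close> can be inverted on every component with \<nu>
  \<noteq> a. Subtracting these preimages from \<psi> leaves a vector that \<open>U - a\<close>
  sends to an \<open>a\<close>-eigenvector or to 0; without Jordan blocks the image is 0, so the
  rest belongs to \<open>a\<close> itself.\<close>

lemma poly_op_eq_0_imp_eigenvector_sum:
  fixes U :: "complex ^ 'n::finite \<Rightarrow> complex ^ 'n"
  assumes U: "unitary_operator U" and "p \<noteq> 0" "poly_op p U \<psi> = 0"
  shows "\<exists>f. (\<forall>\<nu>\<in>eigenvalues U. U (f \<nu>) = \<nu> *s f \<nu>) \<and> \<psi> = (\<Sum>\<nu>\<in>eigenvalues U. f \<nu>)"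
  using assms(2,3)
proof (induction "degree p" arbitrary: p \<psi>)
  case 0
  then obtain c where "p = [:c:]" by (metis degree_eq_zeroE)
  with 0 have "\<psi> = 0" by (simp add: poly_op_def)
  then show ?case by (intro exI[of _ "\<lambda>_. 0"]) (simp add: unitary_operatorD[OF U])
next
  case (Suc n)
  let ?E = "eigenvalues U"
  have fin: "finite ?E" by (rule finite_eigenvalues[OF U])
  have "\<not> constant (poly p)" using Suc.hyps(2) by (simp add: constant_degree)
  then obtain a where "poly p a = 0" using fundamental_theorem_of_algebra by blast
  then obtain q where q: "p = [:- a, 1:] * q" by (metis dvdE poly_eq_0_iff_dvd)
  then have q0: "q \<noteq> 0" using Suc.prems by auto
  have "degree p = degree [:- a, 1:] + degree q"
    unfolding q by (rule degree_mult_eq) (use q0 in auto)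
  then have dq: "n = degree q" using Suc.hyps(2) by simp
  have "poly_op q U (U \<psi> - a *s \<psi>) = 0"
    using Suc.prems(2) by (simp only: q poly_op_mult_linear[OF U])
  from Suc.hyps(1)[OF dq q0 this] obtain f where
    f: "\<And>\<nu>. \<nu> \<in> ?E \<Longrightarrow> U (f \<nu>) = \<nu> *s f \<nu>" "U \<psi> - a *s \<psi> = (\<Sum>\<nu>\<in>?E. f \<nu>)" by blast
  \<comment> \<open>A preimage of \<open>f \<nu>\<close> under \<open>U - a\<close>, except that
    \<open>inverse 0 = 0\<close> makes \<open>g a\<close> zero.\<close>
  define g where "g \<nu> = inverse (\<nu> - a) *s f \<nu>" for \<nu>
  have g: "U (g \<nu>) = \<nu> *s g \<nu>" "U (g \<nu>) - a *s g \<nu> = (if \<nu> = a then 0 else f \<nu>)" if "\<nu> \<in> ?E" for \<nu>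
  proof -
    show *: "U (g \<nu>) = \<nu> *s g \<nu>"
      unfolding g_def unitary_operatorD(3)[OF U] f(1)[OF that] vec.scale_scale
      by (simp only: mult.commute)
    have "\<nu> *s g \<nu> - a *s g \<nu> = ((\<nu> - a) * inverse (\<nu> - a)) *s f \<nu>"
      unfolding g_def vec.scale_scale left_diff_distrib vec.scale_left_diff_distrib ..
    then show "U (g \<nu>) - a *s g \<nu> = (if \<nu> = a then 0 else f \<nu>)" using * by auto
  qed
  define \<xi> where "\<xi> = \<psi> - (\<Sum>\<nu>\<in>?E - {a}. g \<nu>)"
  define \<phi> where "\<phi> = (if a \<in> ?E then f a else 0)"
  have "U \<xi> - a *s \<xi> = (U \<psi> - a *s \<psi>) - (\<Sum>\<nu>\<in>?E - {a}. U (g \<nu>) - a *s g \<nu>)"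
    by (simp add: \<xi>_def unitary_operatorD[OF U] vec.scale_right_diff_distrib
        vec.scale_sum_right sum_subtractf)
  also have "(\<Sum>\<nu>\<in>?E - {a}. U (g \<nu>) - a *s g \<nu>) = (\<Sum>\<nu>\<in>?E - {a}. f \<nu>)"
    by (rule sum.cong) (auto simp: g(2))
  also have "(U \<psi> - a *s \<psi>) - \<dots> = \<phi>"
    unfolding f(2) \<phi>_def using fin by (auto simp: sum.remove[of ?E a])
  finally have \<xi>\<phi>: "U \<xi> - a *s \<xi> = \<phi>" .
  have "U \<phi> = a *s \<phi>" using f(1) by (simp add: \<phi>_def unitary_operatorD[OF U])
  from eigenvector_in_range_eq_0[OF U this \<xi>\<phi>] have \<xi>: "U \<xi> = a *s \<xi>" using \<xi>\<phi> by simp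
  \<comment> \<open>A root of the polynomial may fail to be an eigenvalue; the remainder \<xi> then
    vanishes and needs no slot in the sum.\<close>
  have "a \<in> ?E" if "\<xi> \<noteq> 0" using \<xi> that by (auto simp: eigenvalues_def)
  then have "\<psi> = (\<Sum>\<nu>\<in>?E. (g(a := \<xi>)) \<nu>)"
  proof (cases "a \<in> ?E")
    case True
    then show ?thesis using fin by (simp add: sum.remove[of ?E a] \<xi>_def)
  next
    case False
    then have "\<xi> = 0" using \<open>\<xi> \<noteq> 0 \<Longrightarrow> a \<in> ?E\<close> by blast
    moreover have "(\<Sum>\<nu>\<in>?E. (g(a := \<xi>)) \<nu>) = (\<Sum>\<nu>\<in>?E - {a}. g \<nu>)"
      using False by (intro sum.cong) auto
    ultimately show ?thesis by (simp add: \<xi>_def)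
  qed
  then show ?case using \<xi> g by (intro exI[of _ "g(a := \<xi>)"]) auto
qed

lemma ex_eigenvector_sum:
  fixes U :: "complex ^ 'n::finite \<Rightarrow> complex ^ 'n"
  assumes "unitary_operator U"
  obtains f where "\<And>\<nu>. \<nu> \<in> eigenvalues U \<Longrightarrow> U (f \<nu>) = \<nu> *s f \<nu>"
    and "\<psi> = (\<Sum>\<nu>\<in>eigenvalues U. f \<nu>)"
  using poly_op_eq_0_imp_eigenvector_sum[OF assms] ex_annihilating_poly[of U \<psi>] by blast

text \<open>\<open>U\<close> preserves the inner product but multiplies it by
  \<open>cnj \<nu> * \<mu>\<close>, which is not 1 because \<open>cnj \<nu>\<close> is the inverse
  of \<nu>.\<close>

lemma eigenvectors_orthogonal:
  assumes U: "unitary_operator U" and "U \<phi> = \<nu> *s \<phi>" "U \<psi> = \<mu> *s \<psi>" "\<nu> \<noteq> \<mu>"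
  shows "cinner \<phi> \<psi> = 0"
proof (cases "\<phi> = 0")
  case False
  then have "cmod \<nu> = 1" using U assms(2) by (intro eigenvalue_norm) (auto simp: eigenvalues_def)
  then have n: "\<nu> * cnj \<nu> = 1" by (simp add: complex_norm_square[symmetric])
  have "cnj \<nu> * \<mu> * cinner \<phi> \<psi> = cinner \<phi> \<psi>"
    using unitary_operatorD(6)[OF U, of \<phi> \<psi>] by (simp add: assms cinner_scaleC)
  moreover have "cnj \<nu> * \<mu> \<noteq> 1" using n assms(4) by (metis mult.assoc mult.right_neutral mult_1)
  ultimately show ?thesis by simp
qed (simp add: cinner_def)

lemma norm_eigenvector_sum:
  assumes U: "unitary_operator U" and f: "\<And>\<nu>. \<nu> \<in> A \<Longrightarrow> U (f \<nu>) = \<nu> *s f \<nu>" and "finite A"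
  shows "(norm (\<Sum>\<nu>\<in>A. f \<nu>))\<^sup>2 = (\<Sum>\<nu>\<in>A. (norm (f \<nu>))\<^sup>2)"
  using assms(3) f unfolding power2_norm_eq_inner
  by (intro norm_sum_Pythagorean[unfolded power2_norm_eq_inner])
    (auto simp: pairwise_def orthogonal_def Re_cinner[symmetric] eigenvectors_orthogonal[OF U f f])

section \<open>Separated points on the unit circle\<close>

text \<open>The term 1/(n+1) is the midpoint-rule value for the integral of 1/t over [2n+1, 2n+3],
  an underestimate by convexity. The argument 2n+1 makes the bound exact at 0 and multiplies well in
  the next lemma.\<close>

lemma harm_le_ln: "harm n \<le> ln (2 * real n + 1)"
proof (induction n)
  case 0
  show ?case by (simp add: harm_expand)
next
  case (Suc n)
  have "ln (2 * real (Suc n) + 1) - ln (2 * real n + 1) \<ge>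
      2 * ((2 * real (Suc n) + 1) - (2 * real n + 1)) / ((2 * real n + 1) + (2 * real (Suc n) + 1))"
    by (rule ln_inverse_approx_ge) auto
  also have "2 * ((2 * real (Suc n) + 1) - (2 * real n + 1)) / ((2 * real n + 1) + (2 * real (Suc n) + 1))
      = inverse (real (Suc n))"
    by (simp add: field_simps)
  finally show ?case using Suc by (simp add: harm_Suc)
qed

text \<open>By AM-GM for \<open>2 r + 1\<close> and \<open>2 s + 1\<close>, whose mean is
  \<open>r + s + 1\<close>, an even split of the points is the worst case.\<close>

lemma harm_add_harm_le: "harm r + harm s \<le> 2 * ln (real (r + s + 1))"
proof -
  have "harm r + harm s \<le> ln (2 * real r + 1) + ln (2 * real s + 1)"
    by (intro add_mono harm_le_ln)
  also have "\<dots> = ln ((2 * real r + 1) * (2 * real s + 1))"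
    by (subst ln_mult_pos) auto
  also have "\<dots> \<le> ln ((real (r + s + 1))\<^sup>2)"
  proof (rule ln_mono)
    have "0 \<le> (real r - real s)\<^sup>2" by simp
    then show "(2 * real r + 1) * (2 * real s + 1) \<le> (real (r + s + 1))\<^sup>2"
      by (simp add: power2_eq_square algebra_simps)
  qed (auto intro!: mult_pos_pos)
  also have "\<dots> = 2 * ln (real (r + s + 1))" by (simp add: ln_realpow)
  finally show ?thesis .
qed

text \<open>In increasing order each element exceeds the previous maximum by at least \<delta>, and
  the first is at least \<delta>.\<close>

lemma Max_ge_card_mult:
  fixes A :: "real set"
  assumes "finite A" "A \<noteq> {}" "\<And>a. a \<in> A \<Longrightarrow> \<delta> \<le> a"
    and "\<And>a b. a \<in> A \<Longrightarrow> b \<in> A \<Longrightarrow> a < b \<Longrightarrow> a + \<delta> \<le> b"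
  shows "real (card A) * \<delta> \<le> Max A"
  using assms
proof (induction A rule: finite_linorder_max_induct)
  case (insert b A)
  have card: "card (insert b A) = Suc (card A)" using insert by (simp add: card_insert_if) blast
  have Max: "Max (insert b A) = b" using insert by (intro Max_eqI) (auto intro: less_imp_le)
  show ?case
  proof (cases "A = {}")
    case False
    then have "real (card A) * \<delta> \<le> Max A" using insert by blast
    moreover have "Max A + \<delta> \<le> b" using insert False by (intro insert.prems(3)) auto
    ultimately show ?thesis unfolding card Max by (simp add: algebra_simps)
  qed (use insert in simp)
qed simp

text \<open>The k-th smallest element is at least k\<delta>, so its inverse is at most the k-th
  harmonic term divided by \<delta>.\<close>

lemma sum_inverse_separated_le_harm:
  fixes A :: "real set"
  assumes "0 < \<delta>" "finite A" "\<And>a. a \<in> A \<Longrightarrow> \<delta> \<le> a"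
    and "\<And>a b. a \<in> A \<Longrightarrow> b \<in> A \<Longrightarrow> a < b \<Longrightarrow> a + \<delta> \<le> b"
  shows "(\<Sum>a\<in>A. inverse a) \<le> harm (card A) / \<delta>"
  using assms(2-)
proof (induction A rule: finite_linorder_max_induct)
  case empty
  show ?case by (simp add: harm_expand)
next
  case (insert b A)
  have card: "card (insert b A) = Suc (card A)" using insert by (simp add: card_insert_if) blast
  have Max: "Max (insert b A) = b" using insert by (intro Max_eqI) (auto intro: less_imp_le)
  have "real (card (insert b A)) * \<delta> \<le> Max (insert b A)"
    using insert.hyps insert.prems by (intro Max_ge_card_mult) auto
  then have "real (Suc (card A)) * \<delta> \<le> b" unfolding card Max .
  then have "inverse b \<le> inverse (real (Suc (card A)) * \<delta>)"
    using assms(1) by (intro le_imp_inverse_le) auto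
  moreover have "(\<Sum>a\<in>A. inverse a) \<le> harm (card A) / \<delta>" using insert by blast
  moreover have "b \<notin> A" using insert by blast
  ultimately show ?case using insert.hyps(1) unfolding card
    by (simp add: harm_Suc add_divide_distrib inverse_eq_divide)
qed

text \<open>Split at 0 and reflect the negative elements: each half is a separated set starting at
  \<delta> or later, and the two harmonic numbers combine.\<close>

lemma sum_inverse_abs_separated_le:
  fixes A :: "real set"
  assumes \<delta>: "0 < \<delta>" and fin: "finite A" and "\<And>a. a \<in> A \<Longrightarrow> \<delta> \<le> \<bar>a\<bar>"
    and "\<And>a b. a \<in> A \<Longrightarrow> b \<in> A \<Longrightarrow> a \<noteq> b \<Longrightarrow> \<delta> \<le> \<bar>a - b\<bar>"
  shows "(\<Sum>a\<in>A. inverse \<bar>a\<bar>) \<le> 2 * ln (real (card A + 1)) / \<delta>"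
proof -
  let ?P = "{a\<in>A. 0 < a}" and ?N = "{a\<in>A. a < 0}"
  have "0 \<notin> A" using assms(3)[of 0] \<delta> by auto
  then have A: "A = ?P \<union> ?N" by auto (metis linorder_neqE_linordered_idom)
  have disj: "?P \<inter> ?N = {}" by auto
  have card: "card A = card ?P + card ?N"
    by (subst A, rule card_Un_disjoint) (use fin disj in auto)
  have "(\<Sum>a\<in>?P. inverse a) \<le> harm (card ?P) / \<delta>"
  proof (rule sum_inverse_separated_le_harm[OF \<delta>])
    show "a + \<delta> \<le> b" if "a \<in> ?P" "b \<in> ?P" "a < b" for a b using assms(4)[of a b] that by auto
  qed (use fin assms(3) in force)+
  moreover have "(\<Sum>a\<in>uminus ` ?N. inverse a) \<le> harm (card (uminus ` ?N)) / \<delta>"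
  proof (rule sum_inverse_separated_le_harm[OF \<delta>])
    show "a + \<delta> \<le> b" if "a \<in> uminus ` ?N" "b \<in> uminus ` ?N" "a < b" for a b
      using assms(4)[of "-b" "-a"] that by auto
  qed (use fin assms(3) in force)+
  moreover have "(\<Sum>a\<in>A. inverse \<bar>a\<bar>) = (\<Sum>a\<in>?P. inverse \<bar>a\<bar>) + (\<Sum>a\<in>?N. inverse \<bar>a\<bar>)"
    by (subst A, rule sum.union_disjoint) (use fin disj in auto)
  moreover have "(\<Sum>a\<in>?P. inverse \<bar>a\<bar>) = (\<Sum>a\<in>?P. inverse a)" by (rule sum.cong) auto
  moreover have "(\<Sum>a\<in>?N. inverse \<bar>a\<bar>) = (\<Sum>a\<in>uminus ` ?N. inverse a)"
    by (subst sum.reindex) (auto intro!: sum.cong)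
  moreover have "card (uminus ` ?N) = card ?N" by (rule card_image) auto
  ultimately have "(\<Sum>a\<in>A. inverse \<bar>a\<bar>) \<le> (harm (card ?P) + harm (card ?N)) / \<delta>"
    by (simp add: add_divide_distrib)
  also have "\<dots> \<le> 2 * ln (real (card ?P + card ?N + 1)) / \<delta>"
    using \<delta> harm_add_harm_le by (intro divide_right_mono) auto
  finally show ?thesis using card by simp
qed

section \<open>Chords, geometric sums and phases on the unit circle\<close>

lemma sin_ge_two_div_pi_mult:
  assumes "0 \<le> x" "x \<le> pi / 2"
  shows "2 / pi * x \<le> sin x"
proof -
  \<comment> \<open>Jordan's inequality: a concave function lies above its chord, here the one from
    0 to \<open>pi / 2\<close>.\<close>
  have "concave_on {0..pi / 2} sin"
    by (rule f''_le0_imp_concave[where f' = cos and f'' = "\<lambda>x. - sin x"])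
      (auto intro!: derivative_eq_intros sin_ge_zero)
  from concave_onD_Icc'[OF this, of x] assms show ?thesis by simp
qed

text \<open>The chord has length \<open>2 * \<bar>sin (\<theta> / 2)\<bar>\<close>, and the half
  angle lies in the range of Jordan's inequality.\<close>

lemma dist_1_cis_ge:
  assumes "\<bar>\<theta>\<bar> \<le> pi"
  shows "2 / pi * \<bar>\<theta>\<bar> \<le> cmod (1 - cis \<theta>)"
proof -
  have "2 / pi * (\<bar>\<theta>\<bar> / 2) \<le> sin (\<bar>\<theta>\<bar> / 2)"
    using assms by (intro sin_ge_two_div_pi_mult) auto
  also have "\<dots> \<le> \<bar>sin (\<theta> / 2)\<bar>" by (cases "\<theta> \<ge> 0") auto
  finally show ?thesis
    using dist_exp_i_1[of \<theta>] by (simp add: cis_conv_exp norm_minus_commute)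
qed

lemma norm_sum_power_le:
  fixes z :: complex
  assumes "cmod z = 1" "z \<noteq> 1"
  shows "cmod (\<Sum>t<T. z ^ t) \<le> 2 / cmod (1 - z)"
proof -
  have "cmod (1 - z ^ T) \<le> 1 + cmod (z ^ T)" by (metis norm_one norm_triangle_ineq4)
  then have "cmod (1 - z ^ T) \<le> 2" using assms by (simp add: norm_power)
  moreover have "(\<Sum>t<T. z ^ t) = (1 - z ^ T) / (1 - z)"
    using assms by (simp add: sum_gp_strict)
  ultimately show ?thesis by (simp add: norm_divide divide_right_mono)
qed

lemma cis_Arg_unit: "cmod z = 1 \<Longrightarrow> cis (Arg z) = z"
  using cis_Arg[of z] by (cases "z = 0") (auto simp: sgn_eq)

text \<open>\<open>Arg\<close> moves \<open>a\<close> and \<open>b\<close> by multiples of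
  \<open>2 * pi\<close>, which the infimum over \<open>n\<close> absorbs; so phases may be compared
  through any choice of angles.\<close>

lemma phase_dist_cis_le: "phase_dist (cis a) (cis b) \<le> \<bar>a - b\<bar>"
proof -
  have *: "\<exists>k::int. Arg (cis x) = x + 2 * pi * of_int k" for x
  proof -
    have "cis (Arg (cis x)) = cis x" by (simp add: cis_Arg_unit)
    then have "sin (Arg (cis x)) = sin x \<and> cos (Arg (cis x)) = cos x"
      by (simp add: cis.code)
    then show ?thesis by (simp add: sin_cos_eq_iff mult_ac)
  qed
  obtain k l where k: "Arg (cis a) = a + 2 * pi * of_int k" "Arg (cis b) = b + 2 * pi * of_int l"
    using *[of a] *[of b] by blast
  have "phase_dist (cis a) (cis b) \<le> \<bar>Arg (cis a) - Arg (cis b) + 2 * pi * of_int (l - k)\<bar>"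
    unfolding phase_dist_def by (rule cINF_lower) (auto intro!: bdd_belowI[of _ 0])
  then show ?thesis by (simp add: k algebra_simps)
qed

text \<open>The three gaps around the circle add up to \<open>2 * pi\<close>, so one of them is at
  most a third of a turn.\<close>

lemma three_phases_close:
  fixes u v w :: complex
  assumes "u \<noteq> v" "v \<noteq> w" "w \<noteq> u"
  obtains x y where "x \<in> {u, v, w}" "y \<in> {u, v, w}" "x \<noteq> y" "phase_dist x y \<le> 2 * pi / 3"
proof -
  note witnesses = that
  have bound: "phase_dist x y \<le> \<bar>Arg x - Arg y + 2 * pi * of_int n\<bar>" for x y and n :: int
    unfolding phase_dist_def by (rule cINF_lower) (auto intro!: bdd_belowI[of _ 0])
  have ordered: "phase_dist x y \<le> 2 * pi / 3 \<or> phase_dist y z \<le> 2 * pi / 3 \<or> phase_dist z x \<le> 2 * pi / 3"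
    if "Arg z \<le> Arg y" "Arg y \<le> Arg x" for x y z
  proof -
    have "phase_dist x y \<le> Arg x - Arg y" "phase_dist y z \<le> Arg y - Arg z"
      using bound[of x y 0] bound[of y z 0] that by auto
    \<comment> \<open>This gap crosses the branch cut of \<open>Arg\<close>, hence the shift by one
      turn.\<close>
    moreover have "phase_dist z x \<le> Arg z - Arg x + 2 * pi"
      using bound[of z x 1] mpi_less_Arg[of z] Arg_le_pi[of x] by auto
    ultimately show ?thesis by linarith
  qed
  have thesis if "x \<in> {u, v, w}" "y \<in> {u, v, w}" "z \<in> {u, v, w}" "x \<noteq> y" "y \<noteq> z" "z \<noteq> x"
    "Arg z \<le> Arg y" "Arg y \<le> Arg x" for x y z
    using ordered[OF that(7,8)] witnesses that(1-6) by blast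
  then have *: thesis if "{x, y, z} = {u, v, w}" "x \<noteq> y" "y \<noteq> z" "z \<noteq> x"
    "Arg z \<le> Arg y" "Arg y \<le> Arg x" for x y z
    using that by blast
  consider "Arg u \<le> Arg v" "Arg v \<le> Arg w" | "Arg u \<le> Arg w" "Arg w \<le> Arg v"
    | "Arg v \<le> Arg u" "Arg u \<le> Arg w" | "Arg v \<le> Arg w" "Arg w \<le> Arg u"
    | "Arg w \<le> Arg u" "Arg u \<le> Arg v" | "Arg w \<le> Arg v" "Arg v \<le> Arg u"
    by linarith
  then show thesis
  proof cases
    case 1 show thesis by (rule *[of w v u]) (use 1 assms in auto)
  next
    case 2 show thesis by (rule *[of v w u]) (use 2 assms in auto)
  next
    case 3 show thesis by (rule *[of w u v]) (use 3 assms in auto)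
  next
    case 4 show thesis by (rule *[of u w v]) (use 4 assms in auto)
  next
    case 5 show thesis by (rule *[of v u w]) (use 5 assms in auto)
  next
    case 6 show thesis by (rule *[of u v w]) (use 6 assms in auto)
  qed
qed

text \<open>Rotating \<mu> to 1 turns the other points into angles in (-\<pi>, \<pi>] that keep
  distance \<delta> from each other and from 0. A chord is at least \<open>2 / pi\<close> times its
  angle, which reduces the sum to the one over separated reals.\<close>

lemma sum_inverse_dist_unit_circle_le:
  assumes fin: "finite E" and unit: "\<And>\<nu>. \<nu> \<in> E \<Longrightarrow> cmod \<nu> = 1" and \<delta>: "0 < \<delta>"
    and sep: "\<And>\<nu> \<mu>. \<nu> \<in> E \<Longrightarrow> \<mu> \<in> E \<Longrightarrow> \<nu> \<noteq> \<mu> \<Longrightarrow> \<delta> \<le> phase_dist \<nu> \<mu>" and \<mu>: "\<mu> \<in> E"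
  shows "(\<Sum>\<nu>\<in>E. inverse (cmod (\<nu> - \<mu>))) \<le> pi * ln (real (card E)) / \<delta>"
proof -
  define \<theta> where "\<theta> \<nu> = Arg (\<nu> * cnj \<mu>)" for \<nu>
  have \<mu>1: "\<mu> * cnj \<mu> = 1" using unit[OF \<mu>] by (simp add: complex_norm_square[symmetric])
  have cis: "\<nu> = cis (\<theta> \<nu> + Arg \<mu>)" if "\<nu> \<in> E" for \<nu>
  proof -
    have "cis (\<theta> \<nu>) = \<nu> * cnj \<mu>" unfolding \<theta>_def
      by (rule cis_Arg_unit) (simp add: norm_mult unit that \<mu>)
    then show ?thesis using \<mu>1 by (simp add: cis_mult[symmetric] cis_Arg_unit[OF unit[OF \<mu>]] mult_ac)
  qed
  have \<theta>\<mu>: "\<theta> \<mu> = 0" using \<mu>1 by (simp add: \<theta>_def)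
  have sep': "\<delta> \<le> \<bar>\<theta> \<nu> - \<theta> \<nu>'\<bar>" if "\<nu> \<in> E" "\<nu>' \<in> E" "\<nu> \<noteq> \<nu>'" for \<nu> \<nu>'
    using sep[OF that] phase_dist_cis_le[of "\<theta> \<nu> + Arg \<mu>" "\<theta> \<nu>' + Arg \<mu>"]
    by (simp add: cis[OF that(1), symmetric] cis[OF that(2), symmetric])
  have inj: "inj_on \<theta> (E - {\<mu>})" by (rule inj_onI) (metis DiffD1 cis)
  have term_le: "inverse (cmod (\<nu> - \<mu>)) \<le> pi / 2 * inverse \<bar>\<theta> \<nu>\<bar>" if "\<nu> \<in> E - {\<mu>}" for \<nu>
  proof -
    have "0 < \<bar>\<theta> \<nu>\<bar>" using sep'[of \<nu> \<mu>] that \<mu> \<delta> \<theta>\<mu> by simp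
    moreover have "\<nu> - \<mu> = - (\<mu> * (1 - cis (\<theta> \<nu>)))"
      using cis[of \<nu>] that by (simp add: cis_mult[symmetric] cis_Arg_unit[OF unit[OF \<mu>]] algebra_simps)
    then have "cmod (\<nu> - \<mu>) = cmod (1 - cis (\<theta> \<nu>))"
      by (simp only: norm_minus_cancel norm_mult unit[OF \<mu>] mult_1)
    moreover have "2 / pi * \<bar>\<theta> \<nu>\<bar> \<le> cmod (1 - cis (\<theta> \<nu>))"
      using mpi_less_Arg[of "\<nu> * cnj \<mu>"] Arg_le_pi[of "\<nu> * cnj \<mu>"]
      by (intro dist_1_cis_ge) (simp add: \<theta>_def abs_le_iff)
    ultimately have "inverse (cmod (\<nu> - \<mu>)) \<le> inverse (2 / pi * \<bar>\<theta> \<nu>\<bar>)"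
      by (intro le_imp_inverse_le) auto
    then show ?thesis by (simp add: inverse_eq_divide)
  qed
  \<comment> \<open>The term \<nu> = \<mu> is \<open>inverse 0 = 0\<close>.\<close>
  have "(\<Sum>\<nu>\<in>E. inverse (cmod (\<nu> - \<mu>))) = (\<Sum>\<nu>\<in>E - {\<mu>}. inverse (cmod (\<nu> - \<mu>)))"
    using fin \<mu> by (simp add: sum.remove)
  also have "\<dots> \<le> (\<Sum>\<nu>\<in>E - {\<mu>}. pi / 2 * inverse \<bar>\<theta> \<nu>\<bar>)"
    by (intro sum_mono term_le)
  also have "\<dots> = pi / 2 * (\<Sum>a\<in>\<theta> ` (E - {\<mu>}). inverse \<bar>a\<bar>)"
    by (simp add: sum.reindex[OF inj] sum_distrib_left)
  also have "(\<Sum>a\<in>\<theta> ` (E - {\<mu>}). inverse \<bar>a\<bar>)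
      \<le> 2 * ln (real (card (\<theta> ` (E - {\<mu>})) + 1)) / \<delta>"
  proof (rule sum_inverse_abs_separated_le[OF \<delta>])
    show "finite (\<theta> ` (E - {\<mu>}))" using fin by simp
    show "\<delta> \<le> \<bar>a\<bar>" if "a \<in> \<theta> ` (E - {\<mu>})" for a using that sep'[OF _ \<mu>] \<theta>\<mu> by auto
    show "\<delta> \<le> \<bar>a - b\<bar>" if "a \<in> \<theta> ` (E - {\<mu>})" "b \<in> \<theta> ` (E - {\<mu>})" "a \<noteq> b" for a b
      using that sep' by auto
  qed
  \<comment> \<open>The \<open>+ 1\<close> of the harmonic estimate restores the excluded point
    \<mu>, so the logarithm is that of the full number of points.\<close>
  also have "card (\<theta> ` (E - {\<mu>})) + 1 = card E"
    using fin \<mu> card_gt_0_iff[of E] by (simp add: card_image[OF inj] card_Diff_singleton) auto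
  finally show ?thesis by (simp add: mult_left_mono)
qed

section \<open>Deviation of the time averages\<close>

text \<open>Replace \<open>a i * a j\<close> by the mean of the two squares; by symmetry both halves
  are weighted by the same sums of \<open>M\<close>.\<close>

lemma schur_test_symmetric:
  fixes M :: "'a \<Rightarrow> 'a \<Rightarrow> real" and a :: "'a \<Rightarrow> real"
  assumes "\<And>i j. M i j = M j i" "\<And>i j. 0 \<le> M i j" "\<And>j. j \<in> E \<Longrightarrow> (\<Sum>i\<in>E. M i j) \<le> R"
  shows "(\<Sum>i\<in>E. \<Sum>j\<in>E. M i j * (a i * a j)) \<le> R * (\<Sum>i\<in>E. (a i)\<^sup>2)"
proof -
  have "(\<Sum>i\<in>E. \<Sum>j\<in>E. M i j * (a i * a j)) \<le> (\<Sum>i\<in>E. \<Sum>j\<in>E. M i j * (((a i)\<^sup>2 + (a j)\<^sup>2) / 2))"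
  proof (intro sum_mono mult_left_mono assms)
    fix i j
    have "0 \<le> (a i - a j)\<^sup>2" by simp
    then show "a i * a j \<le> ((a i)\<^sup>2 + (a j)\<^sup>2) / 2" by (simp add: power2_eq_square algebra_simps)
  qed
  also have "\<dots> = ((\<Sum>i\<in>E. \<Sum>j\<in>E. M i j * (a i)\<^sup>2) + (\<Sum>i\<in>E. \<Sum>j\<in>E. M i j * (a j)\<^sup>2)) / 2"
    by (simp add: sum.distrib[symmetric] sum_divide_distrib distrib_left)
  also have "(\<Sum>i\<in>E. \<Sum>j\<in>E. M i j * (a i)\<^sup>2) = (\<Sum>j\<in>E. \<Sum>i\<in>E. M i j * (a j)\<^sup>2)"
    by (intro sum.cong refl) (metis assms(1))
  also have "(\<Sum>i\<in>E. \<Sum>j\<in>E. M i j * (a j)\<^sup>2) = (\<Sum>j\<in>E. \<Sum>i\<in>E. M i j * (a j)\<^sup>2)"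
    by (rule sum.swap)
  also have "((\<Sum>j\<in>E. \<Sum>i\<in>E. M i j * (a j)\<^sup>2) + (\<Sum>j\<in>E. \<Sum>i\<in>E. M i j * (a j)\<^sup>2)) / 2
      = (\<Sum>j\<in>E. (\<Sum>i\<in>E. M i j) * (a j)\<^sup>2)"
    by (simp add: sum_distrib_right)
  also have "\<dots> \<le> (\<Sum>j\<in>E. R * (a j)\<^sup>2)"
    by (intro sum_mono mult_right_mono assms) auto
  finally show ?thesis by (simp add: sum_distrib_left)
qed

section \<open>Time averages in the eigenvector expansion\<close>

lemma sum_cmod_square: "(\<Sum>x\<in>UNIV. (cmod (\<phi> $ x))\<^sup>2) = (norm \<phi>)\<^sup>2"
  by (simp add: norm_vec_def L2_set_def sum_nonneg)

lemma sum_cmod_mult_le: "(\<Sum>x\<in>UNIV. cmod (\<phi> $ x) * cmod (\<psi> $ x)) \<le> norm \<phi> * norm \<psi>"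
  using L2_set_mult_ineq[of "\<lambda>x. cmod (\<phi> $ x)" "\<lambda>x. cmod (\<psi> $ x)" UNIV] by (simp add: norm_vec_def)

lemma funpow_eigenvector_sum:
  assumes "unitary_operator U" "\<And>\<nu>. \<nu> \<in> E \<Longrightarrow> U (f \<nu>) = \<nu> *s f \<nu>"
  shows "(U ^^ t) (\<Sum>\<nu>\<in>E. f \<nu>) = (\<Sum>\<nu>\<in>E. \<nu> ^ t *s f \<nu>)"
proof (induction t)
  case (Suc t)
  then show ?case using assms(2)
    by (auto simp: unitary_operatorD[OF assms(1)] mult.commute intro!: sum.cong)
qed simp

text \<open>Expanding the squared modulus gives one term per pair of eigenvalues, and time enters
  each only through a geometric sum.\<close>

lemma avg_prob_eigenvector_sum:
  assumes "unitary_operator U" "\<And>\<nu>. \<nu> \<in> E \<Longrightarrow> U (f \<nu>) = \<nu> *s f \<nu>"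
  shows "complex_of_real (avg_prob U (\<Sum>\<nu>\<in>E. f \<nu>) T x)
    = (\<Sum>\<nu>\<in>E. \<Sum>\<mu>\<in>E. (\<Sum>t<T. (\<nu> * cnj \<mu>) ^ t) / of_nat T * (f \<nu> $ x * cnj (f \<mu> $ x)))"
proof -
  have "complex_of_real ((cmod ((U ^^ t) (\<Sum>\<nu>\<in>E. f \<nu>) $ x))\<^sup>2)
      = (\<Sum>\<nu>\<in>E. \<Sum>\<mu>\<in>E. (\<nu> * cnj \<mu>) ^ t * (f \<nu> $ x * cnj (f \<mu> $ x)))" for t
  proof -
    have "(U ^^ t) (\<Sum>\<nu>\<in>E. f \<nu>) $ x = (\<Sum>\<nu>\<in>E. \<nu> ^ t * f \<nu> $ x)"
      by (subst funpow_eigenvector_sum[of U E f]) (simp_all add: assms)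
    then show ?thesis
      unfolding complex_norm_square by (simp add: sum_product power_mult_distrib mult_ac)
  qed
  then have "complex_of_real (avg_prob U (\<Sum>\<nu>\<in>E. f \<nu>) T x)
      = 1 / of_nat T * (\<Sum>t<T. \<Sum>\<nu>\<in>E. \<Sum>\<mu>\<in>E. (\<nu> * cnj \<mu>) ^ t * (f \<nu> $ x * cnj (f \<mu> $ x)))"
    by (simp add: avg_prob_def)
  also have "(\<Sum>t<T. \<Sum>\<nu>\<in>E. \<Sum>\<mu>\<in>E. (\<nu> * cnj \<mu>) ^ t * (f \<nu> $ x * cnj (f \<mu> $ x)))
      = (\<Sum>\<nu>\<in>E. \<Sum>t<T. \<Sum>\<mu>\<in>E. (\<nu> * cnj \<mu>) ^ t * (f \<nu> $ x * cnj (f \<mu> $ x)))"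
    by (rule sum.swap)
  also have "\<dots> = (\<Sum>\<nu>\<in>E. \<Sum>\<mu>\<in>E. \<Sum>t<T. (\<nu> * cnj \<mu>) ^ t * (f \<nu> $ x * cnj (f \<mu> $ x)))"
    by (intro sum.cong refl sum.swap)
  finally show ?thesis
    by (simp only: sum_distrib_left sum_distrib_right sum_divide_distrib) (simp add: field_simps)
qed

text \<open>The limit is not yet known to exist, so the estimate is made against some
  \<open>p\<close> that does not depend on \<open>T\<close>; its rate 1/T later identifies
  \<open>p\<close> as the limit.\<close>

lemma avg_prob_deviation_le:
  fixes U :: "complex ^ 'n::finite \<Rightarrow> complex ^ 'n"
  assumes U: "unitary_operator U" and \<psi>: "norm \<psi> = 1" and \<delta>: "0 < \<delta>"
    and sep: "\<And>\<nu> \<mu>. \<nu> \<in> eigenvalues U \<Longrightarrow> \<mu> \<in> eigenvalues U \<Longrightarrow> \<nu> \<noteq> \<mu> \<Longrightarrow> \<delta> \<le> phase_dist \<nu> \<mu>"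
  obtains p where "\<And>T. 1 \<le> T \<Longrightarrow> (\<Sum>x\<in>UNIV. \<bar>avg_prob U \<psi> T x - p x\<bar>)
      \<le> 2 * pi * ln (real (card (eigenvalues U))) / \<delta> / real T"
proof -
  let ?E = "eigenvalues U"
  \<comment> \<open>zero on the diagonal, since \<open>inverse 0 = 0\<close>\<close>
  let ?M = "\<lambda>\<nu> \<mu>. inverse (cmod (\<nu> - \<mu>))"
  have fin: "finite ?E" by (rule finite_eigenvalues[OF U])
  have unit: "cmod \<nu> = 1" if "\<nu> \<in> ?E" for \<nu> by (rule eigenvalue_norm[OF U that])
  obtain f where f: "\<And>\<nu>. \<nu> \<in> ?E \<Longrightarrow> U (f \<nu>) = \<nu> *s f \<nu>" and sum_f: "\<psi> = (\<Sum>\<nu>\<in>?E. f \<nu>)"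
    using ex_eigenvector_sum[OF U] by blast
  define p where "p x = (\<Sum>\<nu>\<in>?E. (cmod (f \<nu> $ x))\<^sup>2)" for x
  have "(\<Sum>x\<in>UNIV. \<bar>avg_prob U \<psi> T x - p x\<bar>) \<le> 2 * pi * ln (real (card ?E)) / \<delta> / real T"
    if T: "1 \<le> T" for T
  proof -
    define S where "S \<nu> \<mu> = (\<Sum>t<T. (\<nu> * cnj \<mu>) ^ t) / of_nat T" for \<nu> \<mu>
    \<comment> \<open>The diagonal weights \<open>S \<nu> \<nu>\<close> are 1 and reproduce
      \<open>p\<close> exactly, so the deviation has the off-diagonal kernel
      \<open>K\<close>.\<close>
    define K where "K \<nu> \<mu> = (if \<nu> = \<mu> then 0 else S \<nu> \<mu>)" for \<nu> \<mu>
    have K: "cmod (K \<nu> \<mu>) \<le> 2 / real T * ?M \<nu> \<mu>" if "\<nu> \<in> ?E" "\<mu> \<in> ?E" for \<nu> \<mu>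
    proof (cases "\<nu> = \<mu>")
      case False
      have \<mu>: "\<mu> * cnj \<mu> = 1" using unit[OF that(2)] by (simp add: complex_norm_square[symmetric])
      have "cmod (1 - \<nu> * cnj \<mu>) = cmod ((\<mu> - \<nu>) * cnj \<mu>)" using \<mu> by (simp add: left_diff_distrib)
      also have "\<dots> = cmod (\<nu> - \<mu>)" using unit[OF that(2)] by (simp add: norm_mult norm_minus_commute)
      finally have d: "cmod (1 - \<nu> * cnj \<mu>) = cmod (\<nu> - \<mu>)" .
      then have "\<nu> * cnj \<mu> \<noteq> 1" using False by auto
      moreover have "cmod (\<nu> * cnj \<mu>) = 1" using unit that by (simp add: norm_mult)
      ultimately have "cmod (\<Sum>t<T. (\<nu> * cnj \<mu>) ^ t) \<le> 2 / cmod (\<nu> - \<mu>)"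
        using norm_sum_power_le[of "\<nu> * cnj \<mu>" T] d by simp
      then have "cmod (\<Sum>t<T. (\<nu> * cnj \<mu>) ^ t) / real T \<le> 2 / cmod (\<nu> - \<mu>) / real T"
        by (rule divide_right_mono) simp
      then show ?thesis using False by (simp add: K_def S_def norm_divide inverse_eq_divide mult.commute)
    qed (simp add: K_def)
    have S1: "S \<nu> \<nu> = 1" if "\<nu> \<in> ?E" for \<nu>
      using unit[OF that] T by (simp add: S_def complex_norm_square[symmetric])
    have dev: "\<bar>avg_prob U \<psi> T x - p x\<bar>
        \<le> (\<Sum>\<nu>\<in>?E. \<Sum>\<mu>\<in>?E. 2 / real T * ?M \<nu> \<mu> * (cmod (f \<nu> $ x) * cmod (f \<mu> $ x)))" for x
    proof -
      have "complex_of_real (p x) = (\<Sum>\<nu>\<in>?E. f \<nu> $ x * cnj (f \<nu> $ x))"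
        unfolding p_def of_real_sum complex_norm_square ..
      also have "\<dots> = (\<Sum>\<nu>\<in>?E. \<Sum>\<mu>\<in>?E. if \<nu> = \<mu> then f \<nu> $ x * cnj (f \<mu> $ x) else 0)"
        using fin by simp
      finally have "complex_of_real (avg_prob U \<psi> T x - p x)
          = (\<Sum>\<nu>\<in>?E. \<Sum>\<mu>\<in>?E. S \<nu> \<mu> * (f \<nu> $ x * cnj (f \<mu> $ x))
              - (if \<nu> = \<mu> then f \<nu> $ x * cnj (f \<mu> $ x) else 0))"
        using avg_prob_eigenvector_sum[OF U f, of ?E T x]
        by (simp only: sum_f[symmetric] S_def of_real_diff sum_subtractf)
      also have "\<dots> = (\<Sum>\<nu>\<in>?E. \<Sum>\<mu>\<in>?E. K \<nu> \<mu> * (f \<nu> $ x * cnj (f \<mu> $ x)))"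
        by (intro sum.cong refl) (simp add: K_def S1)
      finally have "\<bar>avg_prob U \<psi> T x - p x\<bar> = cmod (\<Sum>\<nu>\<in>?E. \<Sum>\<mu>\<in>?E. K \<nu> \<mu> * (f \<nu> $ x * cnj (f \<mu> $ x)))"
        by (metis norm_of_real real_norm_def)
      also have "\<dots> \<le> (\<Sum>\<nu>\<in>?E. \<Sum>\<mu>\<in>?E. cmod (K \<nu> \<mu> * (f \<nu> $ x * cnj (f \<mu> $ x))))"
        by (rule order_trans[OF norm_sum]) (intro sum_mono norm_sum)
      also have "\<dots> \<le> (\<Sum>\<nu>\<in>?E. \<Sum>\<mu>\<in>?E. 2 / real T * ?M \<nu> \<mu> * (cmod (f \<nu> $ x) * cmod (f \<mu> $ x)))"
        unfolding norm_mult complex_mod_cnj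
        by (intro sum_mono mult_right_mono K) auto
      finally show ?thesis .
    qed
    have "(\<Sum>x\<in>UNIV. \<bar>avg_prob U \<psi> T x - p x\<bar>)
        \<le> (\<Sum>x\<in>UNIV. \<Sum>\<nu>\<in>?E. \<Sum>\<mu>\<in>?E. 2 / real T * ?M \<nu> \<mu> * (cmod (f \<nu> $ x) * cmod (f \<mu> $ x)))"
      by (intro sum_mono dev)
    also have "\<dots> = (\<Sum>\<nu>\<in>?E. \<Sum>x\<in>UNIV. \<Sum>\<mu>\<in>?E. 2 / real T * ?M \<nu> \<mu> * (cmod (f \<nu> $ x) * cmod (f \<mu> $ x)))"
      by (rule sum.swap)
    also have "\<dots> = (\<Sum>\<nu>\<in>?E. \<Sum>\<mu>\<in>?E. \<Sum>x\<in>UNIV. 2 / real T * ?M \<nu> \<mu> * (cmod (f \<nu> $ x) * cmod (f \<mu> $ x)))"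
      by (intro sum.cong refl sum.swap)
    \<comment> \<open>Cauchy-Schwarz in \<open>x\<close> for each pair of components.\<close>
    also have "\<dots> \<le> (\<Sum>\<nu>\<in>?E. \<Sum>\<mu>\<in>?E. 2 / real T * ?M \<nu> \<mu> * (norm (f \<nu>) * norm (f \<mu>)))"
      unfolding sum_distrib_left[symmetric] by (intro sum_mono mult_left_mono sum_cmod_mult_le) auto
    also have "\<dots> = 2 / real T * (\<Sum>\<nu>\<in>?E. \<Sum>\<mu>\<in>?E. ?M \<nu> \<mu> * (norm (f \<nu>) * norm (f \<mu>)))"
      by (simp only: sum_distrib_left mult.assoc)
    also have "(\<Sum>\<nu>\<in>?E. \<Sum>\<mu>\<in>?E. ?M \<nu> \<mu> * (norm (f \<nu>) * norm (f \<mu>)))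
        \<le> pi * ln (real (card ?E)) / \<delta> * (\<Sum>\<nu>\<in>?E. (norm (f \<nu>))\<^sup>2)"
      by (rule schur_test_symmetric, simp add: norm_minus_commute, simp,
          rule sum_inverse_dist_unit_circle_le[OF fin unit \<delta> sep])
    \<comment> \<open>Pythagoras for the orthogonal components of the unit vector \<psi>.\<close>
    also have "(\<Sum>\<nu>\<in>?E. (norm (f \<nu>))\<^sup>2) = 1"
      using norm_eigenvector_sum[OF U f fin] \<psi> sum_f by simp
    finally show ?thesis using T by (simp add: mult_left_mono field_simps)
  qed
  then show thesis by (rule that)
qed

section \<open>Conservation of total probability and bounds on the mixing distance\<close>

lemma norm_funpow_unitary:
  assumes "unitary_operator U"
  shows "norm ((U ^^ t) \<psi>) = norm \<psi>"
proof (induction t)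
  case (Suc t)
  have "norm (U \<phi>) = norm \<phi>" for \<phi>
    using unitary_operatorD(6)[OF assms, of \<phi> \<phi>] unfolding cinner_self of_real_eq_iff by simp
  then show ?case using Suc by simp
qed simp

lemma sum_avg_prob:
  assumes "unitary_operator U" "norm \<psi> = 1" "1 \<le> T"
  shows "(\<Sum>x\<in>UNIV. avg_prob U \<psi> T x) = 1"
proof -
  have "(\<Sum>x\<in>UNIV. avg_prob U \<psi> T x) = 1 / real T * (\<Sum>t<T. \<Sum>x\<in>UNIV. (cmod ((U ^^ t) \<psi> $ x))\<^sup>2)"
    unfolding avg_prob_def sum_distrib_left[symmetric] by (rule arg_cong[OF sum.swap])
  then show ?thesis using assms by (simp add: sum_cmod_square norm_funpow_unitary)
qed

text \<open>The deviation bound forces pointwise convergence to \<open>p\<close>. The second bound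
  compares two distributions of total mass 1; it serves large \<epsilon>, where the first may be too
  weak.\<close>

lemma
  fixes U :: "complex ^ 'n::finite \<Rightarrow> complex ^ 'n"
  assumes U: "unitary_operator U" and \<psi>: "norm \<psi> = 1" and \<delta>: "0 < \<delta>"
    and sep: "\<And>\<nu> \<mu>. \<nu> \<in> eigenvalues U \<Longrightarrow> \<mu> \<in> eigenvalues U \<Longrightarrow> \<nu> \<noteq> \<mu> \<Longrightarrow> \<delta> \<le> phase_dist \<nu> \<mu>"
    and T: "1 \<le> T"
  shows mixing_dist_le: "mixing_dist U T \<psi> \<le> 2 * pi * ln (real (card (eigenvalues U))) / \<delta> / real T"
    and mixing_dist_le_2: "mixing_dist U T \<psi> \<le> 2"
proof -
  let ?C = "2 * pi * ln (real (card (eigenvalues U))) / \<delta>"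
  obtain p where p: "\<And>T. 1 \<le> T \<Longrightarrow> (\<Sum>x\<in>UNIV. \<bar>avg_prob U \<psi> T x - p x\<bar>) \<le> ?C / real T"
    using avg_prob_deviation_le[OF U \<psi> \<delta> sep] by blast
  have lim: "(\<lambda>T. avg_prob U \<psi> T x) \<longlonglongrightarrow> p x" for x
  proof -
    have "\<forall>\<^sub>F T in sequentially. norm (avg_prob U \<psi> T x - p x) \<le> ?C / real T"
    proof (rule eventually_sequentiallyI[of 1])
      fix T :: nat assume "1 \<le> T"
      have "\<bar>avg_prob U \<psi> T x - p x\<bar> \<le> (\<Sum>x\<in>UNIV. \<bar>avg_prob U \<psi> T x - p x\<bar>)"
        by (rule member_le_sum) auto
      then show "norm (avg_prob U \<psi> T x - p x) \<le> ?C / real T" using p[OF \<open>1 \<le> T\<close>] by simp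
    qed
    then have "(\<lambda>T. avg_prob U \<psi> T x - p x) \<longlonglongrightarrow> 0"
      by (rule Lim_null_comparison) (rule lim_const_over_n)
    then show ?thesis by (simp add: LIM_zero_iff)
  qed
  then have limit: "limit_prob U \<psi> = p" by (auto simp: limit_prob_def limI)
  show "mixing_dist U T \<psi> \<le> ?C / real T" unfolding mixing_dist_def limit by (rule p[OF T])
  have nonneg: "0 \<le> avg_prob U \<psi> T x" for T x
    by (simp add: avg_prob_def sum_nonneg)
  then have p_nonneg: "0 \<le> p x" for x by (intro LIMSEQ_le_const[OF lim]) auto
  have "(\<lambda>T. \<Sum>x\<in>UNIV. avg_prob U \<psi> T x) \<longlonglongrightarrow> (\<Sum>x\<in>UNIV. p x)"
    by (intro tendsto_sum lim)
  moreover have "(\<lambda>T. \<Sum>x\<in>UNIV. avg_prob U \<psi> T x) \<longlonglongrightarrow> 1"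
    by (rule tendsto_eventually, rule eventually_sequentiallyI[of 1]) (simp add: sum_avg_prob[OF U \<psi>])
  ultimately have "(\<Sum>x\<in>UNIV. p x) = 1" by (rule LIMSEQ_unique)
  moreover have "mixing_dist U T \<psi> \<le> (\<Sum>x\<in>UNIV. avg_prob U \<psi> T x + p x)"
    unfolding mixing_dist_def limit
  proof (rule sum_mono)
    show "\<bar>avg_prob U \<psi> T x - p x\<bar> \<le> avg_prob U \<psi> T x + p x" for x
      using nonneg[of T x] p_nonneg[of x] by linarith
  qed
  ultimately show "mixing_dist U T \<psi> \<le> 2" by (simp add: sum.distrib sum_avg_prob[OF U \<psi> T])
qed

section \<open>From the deviation bound to the mixing time\<close>

text \<open>Two eigenvalues make the set under \<open>Max\<close> nonempty, and it is finite. The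
  inverse of the relaxation time can then play the role of the separation \<delta>.\<close>

lemma
  fixes U :: "complex ^ 'n::finite \<Rightarrow> complex ^ 'n"
  assumes U: "unitary_operator U" and m: "2 \<le> card (eigenvalues U)"
  shows relaxation_time_pos: "0 < relaxation_time U"
    and inverse_relaxation_time_le_phase_dist:
      "\<And>\<nu> \<mu>. \<nu> \<in> eigenvalues U \<Longrightarrow> \<mu> \<in> eigenvalues U \<Longrightarrow> \<nu> \<noteq> \<mu> \<Longrightarrow>
        inverse (relaxation_time U) \<le> phase_dist \<nu> \<mu>"
proof -
  let ?E = "eigenvalues U"
  let ?A = "{inverse (phase_dist \<nu> \<mu>) | \<nu> \<mu>. \<nu> \<in> ?E \<and> \<mu> \<in> ?E \<and> \<nu> \<noteq> \<mu>}"
  have fin: "finite ?E" by (rule finite_eigenvalues[OF U])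
  have "?A \<subseteq> (\<lambda>(\<nu>, \<mu>). inverse (phase_dist \<nu> \<mu>)) ` (?E \<times> ?E)" by auto
  then have finA: "finite ?A" using fin by (meson finite_SigmaI finite_imageI finite_subset)
  have le: "inverse (phase_dist \<nu> \<mu>) \<le> relaxation_time U" and pos: "0 < phase_dist \<nu> \<mu>"
    if "\<nu> \<in> ?E" "\<mu> \<in> ?E" "\<nu> \<noteq> \<mu>" for \<nu> \<mu>
  proof -
    show "inverse (phase_dist \<nu> \<mu>) \<le> relaxation_time U"
      unfolding relaxation_time_def by (rule Max_ge[OF finA]) (use that in blast)
    show "0 < phase_dist \<nu> \<mu>"
      by (intro phase_dist_bounds eigenvalue_norm[OF U] that)
  qed
  obtain \<nu> \<mu> where "\<nu> \<in> ?E" "\<mu> \<in> ?E" "\<nu> \<noteq> \<mu>"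
    using m fin by (metis card_le_Suc0_iff_eq not_less_eq_eq numeral_2_eq_2)
  from le[OF this] pos[OF this] show "0 < relaxation_time U"
    by (meson less_le_trans positive_imp_inverse_positive)
  show "inverse (relaxation_time U) \<le> phase_dist \<nu> \<mu>" if "\<nu> \<in> ?E" "\<mu> \<in> ?E" "\<nu> \<noteq> \<mu>" for \<nu> \<mu>
    using le_imp_inverse_le[OF le[OF that]] pos[OF that] by simp
qed

lemma relaxation_time_ge_of_three:
  fixes U :: "complex ^ 'n::finite \<Rightarrow> complex ^ 'n"
  assumes U: "unitary_operator U" and m: "3 \<le> card (eigenvalues U)"
  shows "3 / (2 * pi) \<le> relaxation_time U"
proof -
  obtain S where "S \<subseteq> eigenvalues U" "card S = 3"
    using m obtain_subset_with_card_n by metis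
  then obtain u v w where "{u, v, w} \<subseteq> eigenvalues U" "u \<noteq> v" "v \<noteq> w" "w \<noteq> u"
    by (auto simp: card_3_iff)
  then obtain x y where "x \<in> eigenvalues U" "y \<in> eigenvalues U" "x \<noteq> y" "phase_dist x y \<le> 2 * pi / 3"
    using three_phases_close[of u v w] by (metis subsetD)
  then have "inverse (relaxation_time U) \<le> 2 * pi / 3"
    using inverse_relaxation_time_le_phase_dist[OF U, of x y] m by simp
  then have "inverse (2 * pi / 3) \<le> inverse (inverse (relaxation_time U))"
    using relaxation_time_pos[OF U] m by (intro le_imp_inverse_le) auto
  then show ?thesis by simp
qed

text \<open>The conclusion is what rounding the threshold down costs: it is equivalent to
  \<open>(T + 1) * ln m \<le> T * ln (2 * m)\<close>. For two eigenvalues \<open>1 \<le> T\<close>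
  suffices; otherwise the lower bound on \<open>r\<close> makes \<open>T\<close> large compared with
  \<open>ln m\<close>.\<close>

lemma ln_le_mult_ln2_of_ge:
  fixes m :: nat and T :: nat and r :: real
  assumes m: "2 \<le> m" and T: "1 \<le> T" and r: "3 \<le> m \<Longrightarrow> 3 / (2 * pi) \<le> r"
    and large: "pi * ln (2 * real m) * r < real T + 1"
  shows "ln (real m) \<le> real T * ln 2"
proof (cases "m = 2")
  case True
  have "1 * ln 2 \<le> real T * ln 2" using T by (intro mult_right_mono) auto
  then show ?thesis using True by simp
next
  case False
  have ln2: "2 / 3 \<le> ln (2 :: real)" by (rule ln2_ge_two_thirds)
  have "ln (2 * real m) = ln 2 + ln (real m)" using m by (simp add: ln_mult_pos)
  moreover have "0 \<le> ln (real m)" using m by simp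
  ultimately have L: "0 \<le> ln (2 * real m)" "ln (2 * real m) = ln 2 + ln (real m)" using ln2 by auto
  have "pi * ln (2 * real m) * (3 / (2 * pi)) \<le> pi * ln (2 * real m) * r"
    using L r False m by (intro mult_left_mono) auto
  then have "3 / 2 * ln (2 * real m) < real T + 1" using large by simp
  \<comment> \<open>Since \<open>ln 2 \<ge> 2 / 3\<close>, the summand \<open>3 / 2 * ln 2\<close>
    is at least 1 and absorbs the \<open>+ 1\<close>.\<close>
  then have "3 / 2 * ln (real m) < real T" using L(2) ln2 by linarith
  moreover have "real T * (2 / 3) \<le> real T * ln 2" using ln2 by (intro mult_left_mono) auto
  ultimately show ?thesis by linarith
qed

text \<open>
  The bound \<open>2 \<pi> ln m t / T\<close> on the mixing distance (\<open>m\<close> eigenvalues, relaxation time \<open>t\<close>) has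
  \<open>ln m\<close> where the theorem has \<open>ln (2 m)\<close>. This slack is needed because times are integers: the
  threshold \<open>2 \<pi> ln (2 m) t / \<epsilon>\<close> has to be rounded down, not up. Where the slack does not suffice, \<open>\<epsilon> > 2\<close> and the trivial
  bound 2 applies; for \<open>m \<ge> 3\<close> this dichotomy relies on \<open>t \<ge> 3 / (2 \<pi>)\<close>.
\<close>

lemma mixing_dist_le_of_floor_le:
  fixes U :: "complex ^ 'n::finite \<Rightarrow> complex ^ 'n" and T N :: nat
  assumes U: "unitary_operator U" and m: "2 \<le> card (eigenvalues U)" and \<psi>: "norm \<psi> = 1"
    and \<epsilon>: "0 < \<epsilon>" and N: "1 \<le> N" "N \<le> T"
    and less: "2 * pi * ln (2 * real (card (eigenvalues U))) * relaxation_time U < \<epsilon> * (real N + 1)"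
  shows "mixing_dist U T \<psi> \<le> \<epsilon>"
proof -
  let ?m = "card (eigenvalues U)" and ?r = "relaxation_time U"
  have r: "0 < ?r" by (rule relaxation_time_pos[OF U m])
  have sep: "inverse ?r \<le> phase_dist \<nu> \<mu>"
    if "\<nu> \<in> eigenvalues U" "\<mu> \<in> eigenvalues U" "\<nu> \<noteq> \<mu>" for \<nu> \<mu>
    by (rule inverse_relaxation_time_le_phase_dist[OF U m that])
  have ir: "0 < inverse ?r" using r by simp
  have T: "1 \<le> T" using N by simp
  show ?thesis
  proof (cases "pi * ln (2 * real ?m) * ?r < real N + 1")
    case False
    then have "2 * (real N + 1) \<le> 2 * (pi * ln (2 * real ?m) * ?r)" by simp
    also have "\<dots> < \<epsilon> * (real N + 1)" using less by (simp only: mult.assoc)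
    finally have "2 * (real N + 1) < \<epsilon> * (real N + 1)" .
    then have "2 < \<epsilon>" by (rule mult_right_less_imp_less) simp
    then show ?thesis using mixing_dist_le_2[OF U \<psi> ir sep T] by linarith
  next
    case True
    have "ln (real ?m) \<le> real N * ln 2"
      using ln_le_mult_ln2_of_ge[OF m N(1) _ True] relaxation_time_ge_of_three[OF U] by blast
    moreover have "ln (2 * real ?m) = ln 2 + ln (real ?m)" using m by (subst ln_mult_pos) auto
    \<comment> \<open>Passing from \<open>ln (2 * m)\<close> to \<open>ln m\<close> gains at least
      the factor N/(N+1) lost by rounding down.\<close>
    ultimately have "(real N + 1) * ln (real ?m) \<le> real N * ln (2 * real ?m)"
      by (simp add: algebra_simps)
    then have "2 * pi * ?r * ((real N + 1) * ln (real ?m)) \<le> 2 * pi * ?r * (real N * ln (2 * real ?m))"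
      using r by (intro mult_left_mono) auto
    also have "\<dots> = real N * (2 * pi * ln (2 * real ?m) * ?r)" by simp
    also have "\<dots> \<le> real N * (\<epsilon> * (real N + 1))" using less by (intro mult_left_mono) auto
    finally have "(2 * pi * ln (real ?m) * ?r) * (real N + 1) \<le> (real N * \<epsilon>) * (real N + 1)"
      by (simp add: mult_ac)
    then have "2 * pi * ln (real ?m) * ?r \<le> real N * \<epsilon>" by (rule mult_right_le_imp_le) simp
    also have "\<dots> \<le> real T * \<epsilon>" using N \<epsilon> by (intro mult_right_mono) auto
    finally have "2 * pi * ln (real ?m) * ?r / real T \<le> \<epsilon>" using T by (simp add: field_simps)
    then show ?thesis using mixing_dist_le[OF U \<psi> ir sep T] by (simp add: field_simps)
  qed
qed

theorem theorem1p1: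
  fixes G :: "('v::finite, 'e) pre_digraph"
    and U :: "complex ^ ('v \<times> 's::finite) \<Rightarrow> complex ^ ('v \<times> 's)"
    and m :: nat and \<epsilon> :: real
  assumes "quantum_walk G U"
    and "m = card (eigenvalues U)"
    and "2 \<le> m"
    and "0 < \<epsilon>"
    and "\<epsilon> \<le> 2 * pi * ln (2 * real m) * relaxation_time U"
  shows "mixing_time U \<epsilon> \<le> ereal (2 * pi * ln (2 * real m) * (relaxation_time U / \<epsilon>))"
proof -
  have U: "unitary_operator U" using assms(1) by (rule quantum_walk.unitary)
  define B where "B = 2 * pi * ln (2 * real m) * (relaxation_time U / \<epsilon>)"
  \<comment> \<open>Rounded down, because \<open>N\<close> will bound the mixing time and must not
    exceed \<open>B\<close>. The upper bound on \<epsilon> gives \<open>1 \<le> B\<close>, which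
    makes \<open>N\<close> an admissible time.\<close>
  define N where "N = nat \<lfloor>B\<rfloor>"
  have B: "\<epsilon> * B = 2 * pi * ln (2 * real m) * relaxation_time U"
    using assms(4) by (simp add: B_def)
  have "1 \<le> B" using assms(4,5) by (simp add: B_def)
  then have N: "1 \<le> N" "real N \<le> B" "B < real N + 1" unfolding N_def by linarith+
  have "\<epsilon> * B < \<epsilon> * (real N + 1)" using N(3) assms(4) by simp
  then have dist: "mixing_dist U T \<psi> \<le> \<epsilon>" if "norm \<psi> = 1" "N \<le> T" for T \<psi>
    using mixing_dist_le_of_floor_le[OF U _ that(1) assms(4) N(1) that(2)] assms(2,3) B by simp
  have "(INF T\<in>{T. 1 \<le> T \<and> (\<forall>T'\<ge>T. mixing_dist U T' \<psi> \<le> \<epsilon>)}. ereal (real T)) \<le> ereal B"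
    if "norm \<psi> = 1" for \<psi>
    by (rule INF_lower2[of N]) (use N dist that in auto)
  then show ?thesis unfolding mixing_time_def B_def[symmetric] by (intro SUP_least) auto
qed

end
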